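(* Let $G$ be a graph and let $(x,y,z)$ be a path of length $2$ in $G$ (that is, $x,y,z$ are distinct vertices with $xy,yz\in E(G)$). Then $$b_{\rm R}(G)\le d_G(x)+d_G(y)+d_G(z)-|N_G(y)\cap N_G(\{x,z\})|-|N_G(x)\cap N_G(z)|-1.$$
   Context: Graphs are finite, undirected, without loops or multiple edges; a graph is nonempty if it has at least one edge. $N_G(x)$ is the set of neighbours of $x$ and $d_G(x)=|N_G(x)|$. For a set $S$ of vertices, $N_G(S)$ is the set of vertices not in $S$ that are adjacent to at least one vertex of $S$. A Roman dominating function on $G=(V,E)$ is a function $f:V\to\{0,1,2\}$ such that every vertex $x$ with $f(x)=0$ is adjacent to at least one vertex $y$ with $f(y)=2$. Its weight is $\sum_{u\in V}f(u)$. The Roman domination number $\gamma_{\rm R}(G)$ is the minimum weight of a Roman dominating function on $G$. The Roman bondage number of a nonempty graph $G$ is $b_{\rm R}(G)=\min\{|B|: B\subseteq E(G),\ \gamma_{\rm R}(G-B)>\gamma_{\rm R}(G)\}$, with $b_{\rm R}(G)=\infty$ if no such $B$ exists; here $G-B$ is obtained from $G$ by deleting the edges in $B$ (keeping all vertices). *)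

theory Defs
  imports Complex_Main "HOL-Library.Extended_Real"
begin

text \<open>A finite graph is given by its vertex set \<open>V\<close> and its edge set \<open>E\<close>, an edge being the
  two-element set of its end vertices; so there are no loops and no multiple edges.\<close>

definition simple_graph :: "'a set \<Rightarrow> 'a set set \<Rightarrow> bool" where
  "simple_graph V E \<longleftrightarrow> finite V \<and> (\<forall>e\<in>E. e \<subseteq> V \<and> card e = 2)"

definition nbrs :: "'a set set \<Rightarrow> 'a \<Rightarrow> 'a set" where
  "nbrs E x = {u. {x, u} \<in> E}"

definition deg :: "'a set set \<Rightarrow> 'a \<Rightarrow> nat" where
  "deg E x = card (nbrs E x)"

definition set_nbrs :: "'a set set \<Rightarrow> 'a set \<Rightarrow> 'a set" where
  "set_nbrs E S = {u. u \<notin> S \<and> (\<exists>s\<in>S. {s, u} \<in> E)}"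

text \<open>Functions on \<open>V\<close> are represented by total functions, whose values outside \<open>V\<close> are irrelevant.\<close>

definition roman_dominating :: "'a set \<Rightarrow> 'a set set \<Rightarrow> ('a \<Rightarrow> nat) \<Rightarrow> bool" where
  "roman_dominating V E f \<longleftrightarrow>
     (\<forall>x\<in>V. f x \<in> {0, 1, 2}) \<and>
     (\<forall>x\<in>V. f x = 0 \<longrightarrow> (\<exists>y\<in>V. {x, y} \<in> E \<and> f y = 2))"

text \<open>The minimum is attained, since the constant function 2 is Roman dominating.\<close>

definition roman_domination_number :: "'a set \<Rightarrow> 'a set set \<Rightarrow> nat" where
  "roman_domination_number V E = (LEAST w. \<exists>f. roman_dominating V E f \<and> w = (\<Sum>u\<in>V. f u))"

text \<open>In \<open>enat\<close> the infimum of a nonempty set is its minimum, and that of the empty set is \<open>\<infinity>\<close>.\<close>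

definition roman_bondage_number :: "'a set \<Rightarrow> 'a set set \<Rightarrow> enat" where
  "roman_bondage_number V E =
     Inf {enat (card B) | B. B \<subseteq> E \<and>
       roman_domination_number V (E - B) > roman_domination_number V E}"

end

theory Submission
  imports Defs
begin

text \<open>Delete all edges at \<open>x\<close>, \<open>y\<close> and \<open>z\<close>, except those joining \<open>y\<close> to
  \<open>N(y) \<inter> N({x, z})\<close> and those joining \<open>x\<close> to a common neighbour of \<open>x\<close> and \<open>z\<close> other
  than \<open>y\<close>. The number of deleted edges is at most the claimed bound, so it is enough that the
  deletion raises the Roman domination number. By
  \<open>roman_domination_number_less\<close> this holds if every Roman dominating function \<open>f\<close> of the smaller
  graph can be turned into a lighter one \<open>g\<close> of \<open>G\<close>.

  Only the values at \<open>x\<close>, \<open>y\<close>, \<open>z\<close> have to be changed (\<open>path_improvement\<close>). The vertex \<open>z\<close> has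
  become isolated, so it carries a positive value that helps no other vertex; this value is saved
  as soon as \<open>z\<close> has a neighbour of value 2 in \<open>G\<close>. The edges that were kept are harmless because
  each of them comes with a deleted partner: if \<open>x\<close> is dominated by \<open>w\<close> after the deletion, then
  \<open>w\<close> dominates \<open>z\<close> in \<open>G\<close>; if \<open>y\<close> is dominated by \<open>w\<close>, then \<open>w\<close> dominates \<open>x\<close> or \<open>z\<close> in
  \<open>G\<close>; and whatever \<open>x\<close> dominates after the deletion can be dominated by \<open>z\<close> in \<open>G\<close>. In the
  remaining cases \<open>x\<close>, \<open>y\<close>, \<open>z\<close> all have positive values. Then a value 2 at \<open>y\<close> saves the value
  of \<open>z\<close>, and a value 2 at \<open>x\<close> saves a value 1 at \<open>y\<close>; if \<open>x\<close> and \<open>y\<close> both have value 1, the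
  total on the path is at least 3, whereas 2 at the middle vertex suffices in \<open>G\<close>.\<close>

lemma roman_domination_number_less:
  assumes "\<And>f. roman_dominating V E' f \<Longrightarrow>
      \<exists>g. roman_dominating V E g \<and> (\<Sum>u\<in>V. g u) < (\<Sum>u\<in>V. f u)"
  shows "roman_domination_number V E < roman_domination_number V E'"
proof -
  have "\<exists>w f. roman_dominating V E' f \<and> w = (\<Sum>u\<in>V. f u)"
    by (intro exI[of _ "\<lambda>_. 2"] exI) (auto simp: roman_dominating_def)
  then have "\<exists>f. roman_dominating V E' f \<and> roman_domination_number V E' = (\<Sum>u\<in>V. f u)"
    unfolding roman_domination_number_def by (rule LeastI_ex)
  then obtain f where f: "roman_dominating V E' f"
      "roman_domination_number V E' = (\<Sum>u\<in>V. f u)"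
    by blast
  obtain g where g: "roman_dominating V E g" "(\<Sum>u\<in>V. g u) < (\<Sum>u\<in>V. f u)"
    using assms[OF f(1)] by blast
  have "roman_domination_number V E \<le> (\<Sum>u\<in>V. g u)"
    unfolding roman_domination_number_def by (rule Least_le) (use g(1) in blast)
  with g(2) f(2) show ?thesis by simp
qed

text \<open>A vertex whose own value is unchanged can lose domination only through a neighbour that
  gave up the value 2; hence only such vertices and the changed ones have to be examined.\<close>

lemma roman_dominating_reassign:
  assumes "roman_dominating V E' f" and "E' \<subseteq> E"
    and changed: "\<And>u. u \<in> V \<Longrightarrow> g u \<noteq> f u \<Longrightarrow>
      g u \<in> {0, 1, 2} \<and> (g u = 0 \<longrightarrow> (\<exists>w\<in>V. {u, w} \<in> E \<and> g w = 2))"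
    and lost: "\<And>u w. u \<in> V \<Longrightarrow> w \<in> V \<Longrightarrow> {u, w} \<in> E' \<Longrightarrow> f w = 2 \<Longrightarrow> g w \<noteq> 2 \<Longrightarrow> g u = 0 \<Longrightarrow>
      \<exists>w'\<in>V. {u, w'} \<in> E \<and> g w' = 2"
  shows "roman_dominating V E g"
  unfolding roman_dominating_def
proof (intro conjI ballI impI)
  fix u assume u: "u \<in> V"
  show "g u \<in> {0, 1, 2}"
    using changed[OF u] assms(1) u unfolding roman_dominating_def by metis
  assume g0: "g u = 0"
  show "\<exists>w\<in>V. {u, w} \<in> E \<and> g w = 2"
  proof (cases "g u = f u")
    case True
    then obtain w where "w \<in> V" "{u, w} \<in> E'" "f w = 2"
      using assms(1) u g0 unfolding roman_dominating_def by metis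
    then show ?thesis using lost[OF u] g0 assms(2) by blast
  next
    case False
    then show ?thesis using changed[OF u] g0 by blast
  qed
qed

lemma sum_three_updates_less:
  fixes f :: "'a \<Rightarrow> nat"
  assumes "finite V" "{x, y, z} \<subseteq> V" "distinct [x, y, z]"
    and "a + b + c < f x + f y + f z"
  shows "(\<Sum>u\<in>V. (f(x := a, y := b, z := c)) u) < (\<Sum>u\<in>V. f u)"
proof -
  have split: "(\<Sum>u\<in>V. h u) = (\<Sum>u\<in>V - {x, y, z}. h u) + (h x + h y + h z)" for h :: "'a \<Rightarrow> nat"
    using assms(1-3) sum.subset_diff[of "{x, y, z}" V h] by simp
  define g where "g = f(x := a, y := b, z := c)"
  have "(\<Sum>u\<in>V - {x, y, z}. g u) = (\<Sum>u\<in>V - {x, y, z}. f u)"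
    by (intro sum.cong) (auto simp: g_def)
  moreover have "g x + g y + g z = a + b + c"
    using assms(3) by (simp add: g_def)
  ultimately show ?thesis
    using assms(4) split[of f] split[of g] by (simp flip: g_def)
qed

text \<open>The four hypotheses on \<open>E'\<close> are all that is used of the deletion: the middle vertex
  \<open>y\<close> is cut off from \<open>x\<close> and \<open>z\<close>, the vertex \<open>z\<close> is isolated, and every edge left at \<open>x\<close> or
  \<open>y\<close> has a partner in \<open>E\<close> at another vertex of the path.\<close>

lemma path_improvement:
  assumes G: "simple_graph V E" and dist: "distinct [x, y, z]"
    and xy: "{x, y} \<in> E" and yz: "{y, z} \<in> E" and sub: "E' \<subseteq> E"
    and isolated: "\<And>u. {z, u} \<notin> E'"
    and cut: "{x, y} \<notin> E'"
    and at_x: "\<And>u. {x, u} \<in> E' \<Longrightarrow> {z, u} \<in> E"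
    and at_y: "\<And>u. {y, u} \<in> E' \<Longrightarrow> {x, u} \<in> E \<or> {z, u} \<in> E"
    and f: "roman_dominating V E' f"
  shows "\<exists>g. roman_dominating V E g \<and> (\<Sum>u\<in>V. g u) < (\<Sum>u\<in>V. f u)"
proof -
  have fin: "finite V" and V: "x \<in> V" "y \<in> V" "z \<in> V"
    using G xy yz by (auto simp: simple_graph_def)
  have noloop: "{u, u} \<notin> E" for u
    using G by (auto simp: simple_graph_def)
  have range: "f u = 0 \<or> f u = 1 \<or> f u = 2" if "u \<in> V" for u
    using f that by (auto simp: roman_dominating_def)
  have dominated: "\<exists>w\<in>V. {u, w} \<in> E' \<and> f w = 2" if "u \<in> V" "f u = 0" for u
    using f that by (auto simp: roman_dominating_def)
  have isolated': "{u, z} \<notin> E'" for u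
    using isolated[of u] by (simp add: insert_commute)
  have fz: "f z > 0"
    using dominated[OF V(3)] isolated by blast
  have improve: ?thesis
    if "roman_dominating V E (f(x := a, y := b, z := c))" "a + b + c < f x + f y + f z" for a b c
    using that(1) sum_three_updates_less[OF fin _ dist that(2)] V by blast
  have drop_value: ?thesis
    if v: "v \<in> {x, y, z}" and "f v > 0" and w: "w \<in> V" "{v, w} \<in> E" "f w = 2"
      and useless: "v = z \<or> f v = 1" for v w
  proof -
    have "roman_dominating V E (f(v := 0))"
    proof (rule roman_dominating_reassign[OF f sub])
      fix u assume "(f(v := 0)) u \<noteq> f u"
      then have "u = v" by (auto split: if_splits)
      moreover have "w \<noteq> v" using w(2) noloop by metis
      ultimately show "(f(v := 0)) u \<in> {0, 1, 2} \<and>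
          ((f(v := 0)) u = 0 \<longrightarrow> (\<exists>w\<in>V. {u, w} \<in> E \<and> (f(v := 0)) w = 2))"
        using w by auto
    next
      fix u t assume "{u, t} \<in> E'" "f t = 2" "(f(v := 0)) t \<noteq> 2"
      then have "t = v" "f v = 2" by (auto split: if_splits)
      then show "\<exists>w'\<in>V. {u, w'} \<in> E \<and> (f(v := 0)) w' = 2"
        using useless \<open>{u, t} \<in> E'\<close> isolated' by auto
    qed
    moreover have "(\<Sum>u\<in>V. (f(v := 0)) u) < (\<Sum>u\<in>V. f u)"
      using fin V v \<open>f v > 0\<close> by (intro sum_strict_mono_ex1) auto
    ultimately show ?thesis by blast
  qed
  have zy: "{z, y} \<in> E" and yx: "{y, x} \<in> E"
    using xy yz by (simp_all add: insert_commute)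
  consider (y2) "f y = 2" | (x0) "f x = 0" | (y0) "f y = 0" "f x = 1 \<or> f x = 2"
    | (y1x2) "f y = 1" "f x = 2" | (y1x1) "f y = 1" "f x = 1"
    using range[OF V(1)] range[OF V(2)] by argo
  then show ?thesis
  proof cases
    case y2
    then show ?thesis using drop_value[of z y] fz zy V by simp
  next
    case x0
    then obtain w where "w \<in> V" "{x, w} \<in> E'" "f w = 2" using dominated V by blast
    then show ?thesis using drop_value[of z w] fz at_x by simp
  next
    case y0
    then obtain w where w: "w \<in> V" "{y, w} \<in> E'" "f w = 2" using dominated V by blast
    have wne: "w \<noteq> x" "w \<noteq> y" "w \<noteq> z"
      using w(2) cut noloop sub isolated' by (auto simp: insert_commute)
    consider "{z, w} \<in> E" | "{x, w} \<in> E" "f x = 1" | "{x, w} \<in> E" "f x = 2"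
      using at_y[OF w(2)] y0(2) by blast
    then show ?thesis
    proof cases
      case 1
      then show ?thesis using drop_value[of z w] fz w by simp
    next
      case 2
      then show ?thesis using drop_value[of x w] w by simp
    next
      case 3
      \<comment> \<open>Here \<open>x\<close> may be needed by its remaining neighbours; they are all neighbours of \<open>z\<close> in
        \<open>E\<close>, so the value 2 moves from \<open>x\<close> to \<open>z\<close> and absorbs the value of \<open>z\<close>.\<close>
      let ?g = "f(x := 0, y := 0, z := 2)"
      have "roman_dominating V E ?g"
      proof (rule roman_dominating_reassign[OF f sub])
        fix u assume "?g u \<noteq> f u"
        then have "u = x \<or> u = z" using y0 by (auto split: if_splits)
        then show "?g u \<in> {0, 1, 2} \<and> (?g u = 0 \<longrightarrow> (\<exists>w\<in>V. {u, w} \<in> E \<and> ?g w = 2))"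
          using w wne 3 dist by auto
      next
        fix u t assume ut: "{u, t} \<in> E'" "f t = 2" "?g t \<noteq> 2"
        then have "t = x" using y0 by (auto split: if_splits)
        then have "{u, z} \<in> E" using ut(1) at_x[of u] by (simp add: insert_commute)
        then show "\<exists>w'\<in>V. {u, w'} \<in> E \<and> ?g w' = 2" using V by auto
      qed
      then show ?thesis using improve 3 fz by simp
    qed
  next
    case y1x2
    then show ?thesis using drop_value[of y x] yx V by simp
  next
    case y1x1
    let ?g = "f(x := 0, y := 2, z := 0)"
    have "roman_dominating V E ?g"
    proof (rule roman_dominating_reassign[OF f sub])
      fix u assume "?g u \<noteq> f u"
      then have "u = x \<or> u = y \<or> u = z" by (auto split: if_splits)
      moreover have "?g y = 2" "?g u \<in> {0, 2}" if "u = x \<or> u = y \<or> u = z"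
        using dist that by auto
      ultimately show "?g u \<in> {0, 1, 2} \<and> (?g u = 0 \<longrightarrow> (\<exists>w\<in>V. {u, w} \<in> E \<and> ?g w = 2))"
        using xy zy V(2) by (metis insertCI insertE singletonD zero_neq_numeral)
    next
      fix u t assume ut: "{u, t} \<in> E'" "f t = 2" "?g t \<noteq> 2"
      then have "t = z" using y1x1 by (auto split: if_splits)
      then show "\<exists>w'\<in>V. {u, w'} \<in> E \<and> ?g w' = 2" using ut(1) isolated' by blast
    qed
    then show ?thesis using improve y1x1 fz by simp
  qed
qed

lemma roman_bondage_number_le:
  assumes "B \<subseteq> E" "roman_domination_number V E < roman_domination_number V (E - B)"
  shows "roman_bondage_number V E \<le> enat (card B)"
  unfolding roman_bondage_number_def by (rule Inf_lower) (use assms in auto)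

lemma finite_nbrs:
  assumes "simple_graph V E"
  shows "finite (nbrs E v)"
  by (rule finite_subset[of _ V]) (use assms in \<open>auto simp: simple_graph_def nbrs_def\<close>)

theorem theorem5p2:
  fixes V :: "'a set" and E :: "'a set set" and x y z :: 'a
  assumes "simple_graph V E"
    and "distinct [x, y, z]"
    and "{x, y} \<in> E" and "{y, z} \<in> E"
  shows "ereal_of_enat (roman_bondage_number V E)
    \<le> ereal (real (deg E x) + real (deg E y) + real (deg E z)
        - real (card (nbrs E y \<inter> set_nbrs E {x, z}))
        - real (card (nbrs E x \<inter> nbrs E z)) - 1)"
proof -
  define C where "C = nbrs E x \<inter> nbrs E z"
  define D where "D = nbrs E y \<inter> set_nbrs E {x, z}"
  \<comment> \<open>As \<open>y\<close> lies in \<open>C\<close>, and \<open>x\<close>, \<open>z\<close> do not lie in \<open>D\<close>, both edges of the path are deleted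
    through the part at \<open>y\<close>; leaving \<open>y\<close> out of the part at \<open>z\<close> avoids counting
    \<open>{y, z}\<close> twice and yields the final \<open>- 1\<close>.\<close>
  define Bx where "Bx = (\<lambda>u. {x, u}) ` (nbrs E x - C)"
  define By where "By = (\<lambda>u. {y, u}) ` (nbrs E y - D)"
  define Bz where "Bz = (\<lambda>u. {z, u}) ` (nbrs E z - {y})"
  define B where "B = Bx \<union> By \<union> Bz"
  note fin = finite_nbrs[OF assms(1)]
  have yz: "y \<in> nbrs E z" and "x \<in> nbrs E y" "z \<in> nbrs E y"
    using assms(3,4) by (simp_all add: nbrs_def insert_commute)
  moreover have "x \<notin> D" "z \<notin> D"
    by (simp_all add: D_def set_nbrs_def)
  ultimately have "{y, x} \<in> B" "{y, z} \<in> B"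
    by (auto simp: B_def By_def)
  then have path: "{x, y} \<in> B" "{z, y} \<in> B"
    by (simp_all add: insert_commute)
  have subE: "B \<subseteq> E"
    by (auto simp: B_def Bx_def By_def Bz_def nbrs_def)
  have "roman_domination_number V E < roman_domination_number V (E - B)"
  proof (rule roman_domination_number_less, rule path_improvement[OF assms])
    show "E - B \<subseteq> E" by blast
    show "{z, u} \<notin> E - B" for u
      using path(2) by (cases "u = y") (auto simp: B_def Bz_def nbrs_def)
    show "{x, y} \<notin> E - B" using path(1) by blast
    show "{z, u} \<in> E" if "{x, u} \<in> E - B" for u
      using that by (auto simp: B_def Bx_def C_def nbrs_def)
    show "{x, u} \<in> E \<or> {z, u} \<in> E" if "{y, u} \<in> E - B" for u
    proof -
      have "u \<in> D" using that by (auto simp: B_def By_def nbrs_def)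
      then show ?thesis by (auto simp: D_def set_nbrs_def)
    qed
  qed
  then have le: "roman_bondage_number V E \<le> enat (card B)"
    using roman_bondage_number_le[OF subE] by blast
  have "card B \<le> card Bx + card By + card Bz"
    unfolding B_def by (meson add_right_mono card_Un_le le_trans)
  also have "\<dots> \<le> card (nbrs E x - C) + card (nbrs E y - D) + card (nbrs E z - {y})"
    unfolding Bx_def By_def Bz_def by (intro add_mono card_image_le finite_Diff fin)
  finally have card_B: "card B \<le> \<dots>" .
  have card_diff: "real (card (nbrs E v - S)) = real (deg E v) - real (card S)"
    if "S \<subseteq> nbrs E v" for v S
    using that fin[of v]
    by (simp add: deg_def card_Diff_subset finite_subset card_mono of_nat_diff)
  have "C \<subseteq> nbrs E x" "D \<subseteq> nbrs E y" "{y} \<subseteq> nbrs E z"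
    using yz by (auto simp: C_def D_def)
  from this[THEN card_diff]
  have bound: "real (card B) \<le> real (deg E x) + real (deg E y) + real (deg E z)
      - real (card D) - real (card C) - 1"
    using of_nat_mono[OF card_B, where 'a = real] by simp
  have "ereal_of_enat (roman_bondage_number V E) \<le> ereal_of_enat (enat (card B))"
    using le by (simp only: ereal_of_enat_le_iff)
  also have "\<dots> \<le> ereal (real (deg E x) + real (deg E y) + real (deg E z)
      - real (card D) - real (card C) - 1)"
    using bound by simp
  finally show ?thesis unfolding C_def D_def .
qed

end
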